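(* If $X$ is a metric space, then $\mathbb{H}_{ft}(X)$ is the Dedekind order completion of $C(X)$, that is, $C(X)^{\#}=\mathbb{H}_{ft}(X)$.
   Context: Let $\overline{\mathbb{R}}=\mathbb{R}\cup\{\pm\infty\}$ and let $\mathbb{I}\overline{\mathbb{R}}=\{[\underline a,\overline a]:\underline a,\overline a\in\overline{\mathbb{R}},\ \underline a\le\overline a\}$ be the set of closed intervals $[\underline a,\overline a]=\{z\in\overline{\mathbb R}:\underline a\le z\le\overline a\}$, partially ordered by $[\underline a,\overline a]\le[\underline b,\overline b]\iff \underline a\le\underline b$ and $\overline a\le\overline b$. A point $x\in\overline{\mathbb{R}}$ is identified with $[x,x]$. For a topological space $X$ let $\mathbb{A}(X)$ be the set of all functions $f:X\to\mathbb{I}\overline{\mathbb{R}}$, ordered pointwise: $f\le g\iff f(x)\le g(x)$ for all $x\in X$. Let $\mathcal{A}(X)\subset\mathbb{A}(X)$ be the set of functions $X\to\overline{\mathbb{R}}$. With $\mathcal{V}_x$ the set of neighborhoods of $x$, define for $f\in\mathbb{A}(X)$ the functions $I(f),S(f)\in\mathcal{A}(X)$ and $F(f)\in\mathbb{A}(X)$ by $I(f)(x)=\sup_{V\in\mathcal{V}_x}\inf\{z\in f(y):y\in V\}$, $S(f)(x)=\inf_{V\in\mathcal{V}_x}\sup\{z\in f(y):y\in V\}$, $F(f)(x)=[I(f)(x),S(f)(x)]$. A function $f\in\mathbb{A}(X)$ is Hausdorff continuous (H-continuous) if for every $g\in\mathbb{A}(X)$ with $g(x)\subseteq f(x)$ for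 all $x\in X$ one has $F(g)(x)=f(x)$ for all $x\in X$. $\mathbb{H}(X)$ is the set of all H-continuous functions on $X$, and $\mathbb{H}_{ft}(X)=\{f\in\mathbb{H}(X): f(x)\subseteq\mathbb{R}\text{ for all }x\in X\}$. $C(X)$ is the set of all continuous functions $X\to\mathbb{R}$; $C(X)\subseteq\mathbb{H}_{ft}(X)$. These sets carry the order induced from $\mathbb{A}(X)$. A partially ordered set $P$ is Dedekind order complete if every nonempty subset of $P$ bounded from above in $P$ has a supremum in $P$ and every nonempty subset of $P$ bounded from below in $P$ has an infimum in $P$. For a subset $P$ of a partially ordered set $Q$ (with the induced order), $Q$ is the Dedekind order completion $P^{\#}$ of $P$ if $Q$ is Dedekind order complete and every element of $Q$ is both the supremum in $Q$ of some subset of $P$ and the infimum in $Q$ of some subset of $P$. *)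

theory Defs
  imports "HOL-Analysis.Analysis" "HOL-Library.Interval" "HOL-Algebra.Order"
begin

text \<open>The order \<open>\<le>\<close> that the library puts on the type of intervals is inclusion.
  The order needed here compares both end points, hence a separate relation.\<close>

definition interval_le :: "ereal interval \<Rightarrow> ereal interval \<Rightarrow> bool" where
  "interval_le a b \<longleftrightarrow> lower a \<le> lower b \<and> upper a \<le> upper b"

definition neighborhoods :: "'a::topological_space \<Rightarrow> 'a set set" where
  "neighborhoods x = {V. \<exists>U. open U \<and> x \<in> U \<and> U \<subseteq> V}"

definition lower_baire :: "('a::topological_space \<Rightarrow> ereal interval) \<Rightarrow> 'a \<Rightarrow> ereal" where
  "lower_baire f x = (SUP V\<in>neighborhoods x. Inf {z. \<exists>y\<in>V. z \<in> set_of (f y)})"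

definition upper_baire :: "('a::topological_space \<Rightarrow> ereal interval) \<Rightarrow> 'a \<Rightarrow> ereal" where
  "upper_baire f x = (INF V\<in>neighborhoods x. Sup {z. \<exists>y\<in>V. z \<in> set_of (f y)})"

text \<open>The abstraction function of the interval type is meaningful only on ordered pairs;
  \<open>lower_baire_le_upper_baire\<close> below shows that it is only used on such.\<close>

definition graph_completion ::
    "('a::topological_space \<Rightarrow> ereal interval) \<Rightarrow> 'a \<Rightarrow> ereal interval" where
  "graph_completion f x = Interval (lower_baire f x, upper_baire f x)"

lemma lower_baire_le_upper_baire: "lower_baire f x \<le> upper_baire f x"
proof -
  have mem: "\<exists>y\<in>V. z \<in> set_of (f y)"
    if "V \<in> neighborhoods x" "z \<in> set_of (f x)" for V z
    using that by (auto simp: neighborhoods_def)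
  have "lower_baire f x \<le> lower (f x)"
    unfolding lower_baire_def
    by (rule SUP_least, rule Inf_lower) (simp add: mem set_of_eq[of "f x"])
  also have "lower (f x) \<le> upper (f x)" by simp
  also have "upper (f x) \<le> upper_baire f x"
    unfolding upper_baire_def
    by (rule INF_greatest, rule Sup_upper) (simp add: mem set_of_eq[of "f x"])
  finally show ?thesis .
qed

lemma lower_graph_completion [simp]: "lower (graph_completion f x) = lower_baire f x"
  and upper_graph_completion [simp]: "upper (graph_completion f x) = upper_baire f x"
  using lower_baire_le_upper_baire[of f x]
  by (simp_all add: graph_completion_def lower_def upper_def Interval_inverse)

definition H_continuous :: "('a::topological_space \<Rightarrow> ereal interval) \<Rightarrow> bool" where
  "H_continuous f \<longleftrightarrow>
     (\<forall>g. (\<forall>x. set_of (g x) \<subseteq> set_of (f x)) \<longrightarrow> (\<forall>x. graph_completion g x = f x))"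

definition H_ft :: "('a::topological_space \<Rightarrow> ereal interval) set" where
  "H_ft = {f. H_continuous f \<and> (\<forall>x. set_of (f x) \<subseteq> range ereal)}"

text \<open>Real functions enter as interval functions through \<open>x \<mapsto> [x, x]\<close>.\<close>

definition C_fun :: "('a::topological_space \<Rightarrow> ereal interval) set" where
  "C_fun = {\<lambda>x. interval_of (ereal (f x)) |f. continuous_on UNIV f}"

definition pointwise_order ::
    "('a \<Rightarrow> ereal interval) set \<Rightarrow> ('a \<Rightarrow> ereal interval) gorder" where
  "pointwise_order S =
     \<lparr>carrier = S, eq = (=), le = (\<lambda>f g. \<forall>x. interval_le (f x) (g x))\<rparr>"

lemma partial_order_pointwise_order: "partial_order (pointwise_order S)"
  by standard
    (auto simp: pointwise_order_def interval_le_def interval_eq_iff fun_eq_iff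
      intro: order_trans order_antisym)

definition dedekind_order_complete :: "('a, 'b) gorder_scheme \<Rightarrow> bool" where
  "dedekind_order_complete L \<longleftrightarrow> partial_order L \<and>
     (\<forall>A. A \<subseteq> carrier L \<and> A \<noteq> {} \<and> Upper L A \<noteq> {} \<longrightarrow> (\<exists>s. is_lub L s A)) \<and>
     (\<forall>A. A \<subseteq> carrier L \<and> A \<noteq> {} \<and> Lower L A \<noteq> {} \<longrightarrow> (\<exists>i. is_glb L i A))"

definition is_dedekind_completion :: "('a, 'b) gorder_scheme \<Rightarrow> 'a set \<Rightarrow> bool" where
  "is_dedekind_completion Q P \<longleftrightarrow>
     P \<subseteq> carrier Q \<and> dedekind_order_complete Q \<and>
     (\<forall>q\<in>carrier Q. (\<exists>A\<subseteq>P. is_lub Q q A) \<and> (\<exists>B\<subseteq>P. is_glb Q q B))"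

end

theory Submission
  imports Defs
begin

text \<open>
  The Baire operators \<open>I\<close> and \<open>S\<close> are the lower and upper limits along the neighborhood filter,
  and they are monotone and idempotent.  An interval function \<open>f = [l, u]\<close> is H-continuous exactly
  when \<open>S l = u\<close> and \<open>I u = l\<close> (\<open>H_continuous_iff\<close>).  So each end point function determines the
  other monotonically, and comparing two H-continuous functions amounts to comparing their lower
  end points alone, or their upper end points alone (\<open>H_le_iff_lower\<close>, \<open>H_le_iff_upper\<close>).

  Completeness.  Given a nonempty family of H-continuous functions that is bounded above, the
  pointwise supremum \<open>\<phi>\<close> of the lower end points satisfies \<open>\<phi> = I \<phi>\<close>, hence
  \<open>\<phi> \<le> I (S \<phi>) \<le> S \<phi>\<close>.  Applying \<open>S\<close> gives \<open>S (I (S \<phi>)) = S \<phi>\<close>, so \<open>[I (S \<phi>), S \<phi>]\<close> is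
  H-continuous.  It is squeezed between a member
  of the family and an upper bound, hence finite, and it is the supremum (\<open>H_ft_has_lub\<close>).
  Infima then exist for purely order-theoretic reasons.

  Density.  Here the metric enters.  The lower end point function \<open>l\<close> of a finite H-continuous
  function is a real lower semicontinuous function, possibly unbounded below.
  Its exponential is positive and lower semicontinuous, so its Lipschitz regularizations
  \<open>\<lambda>x. inf\<^sub>y (exp (l y) + k * dist x y)\<close> are positive, continuous, and increase to \<open>exp l\<close> as
  \<open>k \<rightarrow> \<infinity>\<close>.  Their logarithms are continuous minorants of \<open>l\<close> whose pointwise supremum is \<open>l\<close>
  (\<open>lsc_continuous_minorant\<close>).  As lower end points decide the order, the given function is the
  supremum of the continuous functions below it; the case of infima follows by negation.
\<close>

section \<open>Baire operators as limits along the neighborhood filter\<close>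

lemma neighborhoods_eq: "neighborhoods x = Collect ` {P. eventually P (nhds x)}"
proof -
  have "V \<in> neighborhoods x \<longleftrightarrow> eventually (\<lambda>y. y \<in> V) (nhds x)" for V
    unfolding neighborhoods_def eventually_nhds by blast
  moreover have "V \<in> Collect ` {P. eventually P (nhds x)} \<longleftrightarrow> eventually (\<lambda>y. y \<in> V) (nhds x)" for V
  proof
    assume "eventually (\<lambda>y. y \<in> V) (nhds x)"
    then show "V \<in> Collect ` {P. eventually P (nhds x)}"
      by (intro image_eqI[of _ _ "\<lambda>y. y \<in> V"]) simp_all
  qed auto
  ultimately show ?thesis by blast
qed

lemma lower_baire_eq_Liminf: "lower_baire f x = Liminf (nhds x) (\<lambda>y. lower (f y))"
proof -
  have "Inf {z. \<exists>y\<in>V. z \<in> set_of (f y)} = (INF y\<in>V. lower (f y))" for V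
  proof (rule antisym)
    show "Inf {z. \<exists>y\<in>V. z \<in> set_of (f y)} \<le> (INF y\<in>V. lower (f y))"
    proof (rule INF_greatest, rule Inf_lower)
      fix y assume "y \<in> V"
      moreover have "lower (f y) \<in> set_of (f y)" by (simp add: set_of_eq)
      ultimately show "lower (f y) \<in> {z. \<exists>y\<in>V. z \<in> set_of (f y)}" by blast
    qed
    show "(INF y\<in>V. lower (f y)) \<le> Inf {z. \<exists>y\<in>V. z \<in> set_of (f y)}"
    proof (rule Inf_greatest)
      fix z assume "z \<in> {z. \<exists>y\<in>V. z \<in> set_of (f y)}"
      then obtain y where "y \<in> V" "lower (f y) \<le> z" by (auto simp: set_of_eq)
      then show "(INF y\<in>V. lower (f y)) \<le> z" by (rule INF_lower2)
    qed
  qed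
  then show ?thesis
    by (simp add: lower_baire_def Liminf_def neighborhoods_eq image_image)
qed

lemma upper_baire_eq_Limsup: "upper_baire f x = Limsup (nhds x) (\<lambda>y. upper (f y))"
proof -
  have "Sup {z. \<exists>y\<in>V. z \<in> set_of (f y)} = (SUP y\<in>V. upper (f y))" for V
  proof (rule antisym)
    show "Sup {z. \<exists>y\<in>V. z \<in> set_of (f y)} \<le> (SUP y\<in>V. upper (f y))"
    proof (rule Sup_least)
      fix z assume "z \<in> {z. \<exists>y\<in>V. z \<in> set_of (f y)}"
      then obtain y where "y \<in> V" "z \<le> upper (f y)" by (auto simp: set_of_eq)
      then show "z \<le> (SUP y\<in>V. upper (f y))" by (rule SUP_upper2)
    qed
    show "(SUP y\<in>V. upper (f y)) \<le> Sup {z. \<exists>y\<in>V. z \<in> set_of (f y)}"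
    proof (rule SUP_least, rule Sup_upper)
      fix y assume "y \<in> V"
      moreover have "upper (f y) \<in> set_of (f y)" by (simp add: set_of_eq)
      ultimately show "upper (f y) \<in> {z. \<exists>y\<in>V. z \<in> set_of (f y)}" by blast
    qed
  qed
  then show ?thesis
    by (simp add: upper_baire_def Limsup_def neighborhoods_eq image_image)
qed

lemma Liminf_nhds_le: "Liminf (nhds x) \<phi> \<le> \<phi> x"
  for \<phi> :: "'a::topological_space \<Rightarrow> 'b::complete_lattice"
  unfolding Liminf_def by (rule SUP_least) (auto intro!: INF_lower dest: eventually_nhds_x_imp_x)

lemma le_Limsup_nhds: "\<phi> x \<le> Limsup (nhds x) \<phi>"
  for \<phi> :: "'a::topological_space \<Rightarrow> 'b::complete_lattice"
  unfolding Limsup_def by (rule INF_greatest) (auto intro!: SUP_upper dest: eventually_nhds_x_imp_x)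

text \<open>A property that holds eventually near \<open>x\<close> holds eventually near every point close to \<open>x\<close>,
  and therefore taking the lower limit twice gives nothing new.\<close>

lemma Liminf_nhds_idem:
  "Liminf (nhds x) (\<lambda>y. Liminf (nhds y) \<phi>) = Liminf (nhds x) \<phi>"
  for \<phi> :: "'a::topological_space \<Rightarrow> ereal"
proof (rule antisym)
  show "Liminf (nhds x) (\<lambda>y. Liminf (nhds y) \<phi>) \<le> Liminf (nhds x) \<phi>"
    by (intro Liminf_mono always_eventually allI Liminf_nhds_le)
  show "Liminf (nhds x) \<phi> \<le> Liminf (nhds x) (\<lambda>y. Liminf (nhds y) \<phi>)"
    unfolding le_Liminf_iff[where C = "Liminf (nhds x) \<phi>"]
  proof (intro allI impI)
    fix t assume "t < Liminf (nhds x) \<phi>"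
    then obtain s where s: "t < s" "s < Liminf (nhds x) \<phi>"
      using dense by blast
    then have "eventually (\<lambda>y. eventually (\<lambda>z. s < \<phi> z) (nhds y)) (nhds x)"
      by (simp add: eventually_eventually less_LiminfD)
    then show "eventually (\<lambda>y. t < Liminf (nhds y) \<phi>) (nhds x)"
    proof eventually_elim
      case (elim y)
      then have "s \<le> Liminf (nhds y) \<phi>"
        by (intro Liminf_bounded) (auto elim: eventually_mono)
      with s show ?case by simp
    qed
  qed
qed

lemma Limsup_nhds_idem:
  "Limsup (nhds x) (\<lambda>y. Limsup (nhds y) \<phi>) = Limsup (nhds x) \<phi>"
  for \<phi> :: "'a::topological_space \<Rightarrow> ereal"
  using Liminf_nhds_idem[of x "\<lambda>y. - \<phi> y"] by (simp add: ereal_Liminf_uminus)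

section \<open>H-continuity in terms of the end points\<close>

text \<open>Necessity comes from applying the definition to the smallest and to the largest point-valued
  selection of \<open>f\<close>.  Conversely, the equations and idempotence make both operators send each of
  these two selections to the end points of \<open>f\<close>; every other selection lies between the two, and
  the operators are monotone.\<close>

lemma H_continuous_iff:
  "H_continuous f \<longleftrightarrow>
     (\<forall>x. Limsup (nhds x) (\<lambda>y. lower (f y)) = upper (f x)) \<and>
     (\<forall>x. Liminf (nhds x) (\<lambda>y. upper (f y)) = lower (f x))"
  (is "_ \<longleftrightarrow> ?S \<and> ?I")
proof (intro iffI conjI)
  assume H: "H_continuous f"
  have "graph_completion (\<lambda>y. interval_of (lower (f y))) x = f x" for x
    using H unfolding H_continuous_def by (auto simp: set_of_eq)
  from this[THEN arg_cong[where f = upper]] show ?S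
    by (simp add: upper_baire_eq_Limsup)
  have "graph_completion (\<lambda>y. interval_of (upper (f y))) x = f x" for x
    using H unfolding H_continuous_def by (auto simp: set_of_eq)
  from this[THEN arg_cong[where f = lower]] show ?I
    by (simp add: lower_baire_eq_Liminf)
next
  assume SI: "?S \<and> ?I"
  have l: "Liminf (nhds x) (\<lambda>y. lower (f y)) = lower (f x)" for x
    using Liminf_nhds_idem[of x "\<lambda>y. upper (f y)"] SI by simp
  have u: "Limsup (nhds x) (\<lambda>y. upper (f y)) = upper (f x)" for x
    using Limsup_nhds_idem[of x "\<lambda>y. lower (f y)"] SI by simp
  show "H_continuous f"
    unfolding H_continuous_def
  proof (intro allI impI)
    fix g x assume "\<forall>x. set_of (g x) \<subseteq> set_of (f x)"
    then have g: "lower (f y) \<le> lower (g y)" "upper (g y) \<le> upper (f y)" for y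
      by (simp_all add: set_of_eq)
    have g': "lower (g y) \<le> upper (f y)" "lower (f y) \<le> upper (g y)" for y
      using g[of y] lower_le_upper[of "g y"] by (blast intro: order_trans)+
    have "lower_baire g x = lower (f x)"
      using Liminf_mono[of "\<lambda>y. lower (f y)" "\<lambda>y. lower (g y)" "nhds x"]
        Liminf_mono[of "\<lambda>y. lower (g y)" "\<lambda>y. upper (f y)" "nhds x"] g g' l SI
      by (intro antisym) (simp_all add: lower_baire_eq_Liminf)
    moreover have "upper_baire g x = upper (f x)"
      using Limsup_mono[of "\<lambda>y. lower (f y)" "\<lambda>y. upper (g y)" "nhds x"]
        Limsup_mono[of "\<lambda>y. upper (g y)" "\<lambda>y. upper (f y)" "nhds x"] g g' u SI
      by (intro antisym) (simp_all add: upper_baire_eq_Limsup)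
    ultimately show "graph_completion g x = f x"
      by (simp add: interval_eq_iff)
  qed
qed

lemma H_le_iff_lower:
  assumes "H_continuous f" "H_continuous g"
  shows "(\<forall>x. interval_le (f x) (g x)) \<longleftrightarrow> (\<forall>x. lower (f x) \<le> lower (g x))"
proof -
  have "upper (f x) \<le> upper (g x)" if "\<forall>x. lower (f x) \<le> lower (g x)" for x
    using assms Limsup_mono[of "\<lambda>y. lower (f y)" "\<lambda>y. lower (g y)" "nhds x"] that
    by (simp add: H_continuous_iff)
  then show ?thesis
    by (auto simp: interval_le_def)
qed

lemma H_le_iff_upper:
  assumes "H_continuous f" "H_continuous g"
  shows "(\<forall>x. interval_le (f x) (g x)) \<longleftrightarrow> (\<forall>x. upper (f x) \<le> upper (g x))"
proof -
  have "lower (f x) \<le> lower (g x)" if "\<forall>x. upper (f x) \<le> upper (g x)" for x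
    using assms Liminf_mono[of "\<lambda>y. upper (f y)" "\<lambda>y. upper (g y)" "nhds x"] that
    by (simp add: H_continuous_iff)
  then show ?thesis
    by (auto simp: interval_le_def)
qed

lemma Liminf_lower_H_continuous:
  assumes "H_continuous f"
  shows "Liminf (nhds x) (\<lambda>y. lower (f y)) = lower (f x)"
  using assms Liminf_nhds_idem[of x "\<lambda>y. upper (f y)"] by (simp add: H_continuous_iff)

lemma H_ft_iff_finite_ends:
  "f \<in> H_ft \<longleftrightarrow> H_continuous f \<and> (\<forall>x. - \<infinity> < lower (f x) \<and> upper (f x) < \<infinity>)"
proof -
  have "set_of i \<subseteq> range ereal \<longleftrightarrow> - \<infinity> < lower i \<and> upper i < \<infinity>" for i :: "ereal interval"
  proof
    assume i: "set_of i \<subseteq> range ereal"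
    have "lower i \<in> set_of i" "upper i \<in> set_of i"
      by (simp_all add: set_of_eq)
    with i have "lower i \<in> range ereal" "upper i \<in> range ereal"
      by blast+
    then show "- \<infinity> < lower i \<and> upper i < \<infinity>" by auto
  next
    assume i: "- \<infinity> < lower i \<and> upper i < \<infinity>"
    show "set_of i \<subseteq> range ereal"
    proof
      fix z assume "z \<in> set_of i"
      with i show "z \<in> range ereal"
        by (cases z) (auto simp: set_of_eq)
    qed
  qed
  then show ?thesis by (simp add: H_ft_def)
qed

lemma H_ft_lower_real:
  assumes "f \<in> H_ft"
  shows "ereal (real_of_ereal (lower (f x))) = lower (f x)"
proof -
  have "- \<infinity> < lower (f x)" "upper (f x) < \<infinity>" "lower (f x) \<le> upper (f x)"
    using assms by (auto simp: H_ft_iff_finite_ends)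
  then show ?thesis
    by (cases "lower (f x)"; cases "upper (f x)"; simp)
qed

lemma C_fun_subset_H_ft: "C_fun \<subseteq> H_ft"
proof
  fix f :: "'a \<Rightarrow> ereal interval" assume "f \<in> C_fun"
  then obtain c where f: "f = (\<lambda>x. interval_of (ereal (c x)))" and c: "continuous_on UNIV c"
    by (auto simp: C_fun_def)
  have "((\<lambda>y. ereal (c y)) \<longlongrightarrow> ereal (c x)) (nhds x)" for x
    using c by (intro tendsto_ereal)
      (simp add: continuous_on_def tendsto_at_iff_tendsto_nhds[symmetric])
  then have "Liminf (nhds x) (\<lambda>y. ereal (c y)) = ereal (c x)"
    "Limsup (nhds x) (\<lambda>y. ereal (c y)) = ereal (c x)" for x
    by (simp_all add: lim_imp_Liminf lim_imp_Limsup)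
  then show "f \<in> H_ft"
    by (simp add: H_ft_iff_finite_ends H_continuous_iff f)
qed

section \<open>Order completeness\<close>

lemma carrier_pointwise_order [simp]: "carrier (pointwise_order S) = S"
  and le_pointwise_order [simp]:
    "f \<sqsubseteq>\<^bsub>pointwise_order S\<^esub> g \<longleftrightarrow> (\<forall>x. interval_le (f x) (g x))"
  by (simp_all add: pointwise_order_def)

lemma is_lub_pointwise_orderI:
  assumes "A \<subseteq> S" "s \<in> S" "\<And>f. f \<in> A \<Longrightarrow> \<forall>x. interval_le (f x) (s x)"
    and "\<And>h. h \<in> S \<Longrightarrow> (\<And>f. f \<in> A \<Longrightarrow> \<forall>x. interval_le (f x) (h x)) \<Longrightarrow>
      \<forall>x. interval_le (s x) (h x)"
  shows "is_lub (pointwise_order S) s A"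
proof -
  have "\<forall>x. interval_le (s x) (h x)" if "h \<in> Upper (pointwise_order S) A" for h
  proof (rule assms(4))
    show "h \<in> S" using that by (simp add: Upper_def)
    show "\<forall>x. interval_le (f x) (h x)" if "f \<in> A" for f
      using \<open>h \<in> Upper (pointwise_order S) A\<close> that assms(1) by (auto simp: Upper_def)
  qed
  then show ?thesis
    using assms(2,3) by (auto simp: least_def Upper_def)
qed

text \<open>The infimum of \<open>A\<close> is the supremum of its lower bounds, a set that every member of \<open>A\<close>
  bounds from above.\<close>

lemma dedekind_order_complete_if_lubs:
  assumes "partial_order L"
    and lub: "\<And>A. A \<subseteq> carrier L \<Longrightarrow> A \<noteq> {} \<Longrightarrow> Upper L A \<noteq> {} \<Longrightarrow> \<exists>s. is_lub L s A"
  shows "dedekind_order_complete L"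
  unfolding dedekind_order_complete_def
proof (intro conjI allI impI)
  fix A assume A: "A \<subseteq> carrier L \<and> A \<noteq> {} \<and> Lower L A \<noteq> {}"
  then have A_le: "A \<subseteq> Upper L (Lower L A)"
    by (auto simp: Upper_def Lower_def)
  with A obtain i where i: "is_lub L i (Lower L A)"
    using lub[of "Lower L A"] by (auto simp: Lower_def)
  then have "is_glb L i A"
    using A A_le
    by (auto simp: least_def greatest_def Upper_def Lower_def)
  then show "\<exists>i. is_glb L i A" ..
qed (use assms in auto)

text \<open>The pointwise supremum \<open>\<phi>\<close> of the lower end points is lower semicontinuous, but it need not
  be the lower end point of an H-continuous function; \<open>l = I (S \<phi>)\<close> is the smallest such function
  above it.\<close>

lemma H_ft_has_lub:
  fixes A :: "('a::topological_space \<Rightarrow> ereal interval) set"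
  assumes A: "A \<subseteq> H_ft" "A \<noteq> {}" and bdd: "Upper (pointwise_order H_ft) A \<noteq> {}"
  shows "\<exists>s. is_lub (pointwise_order H_ft) s A"
proof -
  define \<phi> where "\<phi> y = (SUP f\<in>A. lower (f y))" for y
  define u where "u x = Limsup (nhds x) \<phi>" for x
  define l where "l x = Liminf (nhds x) u" for x
  define s where "s = graph_completion (\<lambda>x. interval_of (u x))"
  have u_idem: "Limsup (nhds x) u = u x" for x
    using Limsup_nhds_idem[of x \<phi>] by (simp flip: u_def)
  have lower_s: "lower (s x) = l x" and upper_s: "upper (s x) = u x" for x
    by (simp_all add: s_def lower_baire_eq_Liminf upper_baire_eq_Limsup u_idem flip: l_def)
  have HA: "H_continuous f" if "f \<in> A" for f
    using A that by (auto simp: H_ft_def)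
  have le_\<phi>: "lower (f x) \<le> \<phi> x" if "f \<in> A" for f x
    unfolding \<phi>_def using that by (rule SUP_upper)
  have "lower (f x) \<le> Liminf (nhds x) \<phi>" if "f \<in> A" for f x
    using Liminf_mono[of "\<lambda>y. lower (f y)" \<phi> "nhds x"] le_\<phi>[OF that]
    by (simp add: Liminf_lower_H_continuous HA[OF that])
  then have "\<phi> x \<le> Liminf (nhds x) \<phi>" for x
    unfolding \<phi>_def[of x] by (intro SUP_least) auto
  also have "Liminf (nhds x) \<phi> \<le> l x" for x
    unfolding l_def u_def by (intro Liminf_mono always_eventually allI le_Limsup_nhds)
  finally have \<phi>_le_l: "\<phi> x \<le> l x" for x .
  have l_le_u: "l x \<le> u x" for x
    unfolding l_def by (rule Liminf_nhds_le)
  have "Limsup (nhds x) l = u x" for x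
    using Limsup_mono[of \<phi> l "nhds x"] Limsup_mono[of l u "nhds x"] \<phi>_le_l l_le_u
    by (intro antisym) (simp_all add: u_idem flip: u_def)
  then have Hs: "H_continuous s"
    by (simp add: H_continuous_iff lower_s upper_s flip: l_def)
  have s_le: "\<forall>x. interval_le (s x) (h x)"
    if h: "H_continuous h" "\<And>f. f \<in> A \<Longrightarrow> \<forall>x. interval_le (f x) (h x)" for h
  proof -
    have "\<phi> x \<le> lower (h x)" for x
      unfolding \<phi>_def using h(2) by (intro SUP_least) (auto simp: interval_le_def)
    then have "u x \<le> upper (h x)" for x
      using Limsup_mono[of \<phi> "\<lambda>y. lower (h y)" "nhds x"] h(1)
      by (simp add: H_continuous_iff u_def)
    then show ?thesis
      using H_le_iff_upper[OF Hs h(1)] by (simp add: upper_s)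
  qed
  have le_s: "\<forall>x. interval_le (f x) (s x)" if "f \<in> A" for f
    using H_le_iff_lower[OF HA[OF that] Hs] order_trans[OF le_\<phi>[OF that] \<phi>_le_l]
    by (simp add: lower_s)
  obtain h where h: "h \<in> H_ft" "\<And>f. f \<in> A \<Longrightarrow> \<forall>x. interval_le (f x) (h x)"
    using bdd A by (auto simp: Upper_def)
  obtain f where f: "f \<in> A" using A by auto
  have "s \<in> H_ft"
    unfolding H_ft_iff_finite_ends
  proof (intro conjI allI Hs)
    fix x
    have "- \<infinity> < lower (f x)" "upper (h x) < \<infinity>"
      using f A h by (auto simp: H_ft_iff_finite_ends)
    moreover have "lower (f x) \<le> lower (s x)" "upper (s x) \<le> upper (h x)"
      using le_s[OF f] s_le[OF _ h(2)] h(1) by (auto simp: interval_le_def H_ft_def)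
    ultimately show "- \<infinity> < lower (s x)" "upper (s x) < \<infinity>" by auto
  qed
  then have "is_lub (pointwise_order H_ft) s A"
    using A le_s s_le by (intro is_lub_pointwise_orderI) (auto simp: H_ft_def)
  then show ?thesis by blast
qed

lemma dedekind_order_complete_H_ft: "dedekind_order_complete (pointwise_order H_ft)"
  by (rule dedekind_order_complete_if_lubs)
    (simp_all add: partial_order_pointwise_order H_ft_has_lub)

section \<open>Approximation by continuous functions\<close>

definition lipschitz_regularization :: "real \<Rightarrow> ('a::metric_space \<Rightarrow> real) \<Rightarrow> 'a \<Rightarrow> real" where
  "lipschitz_regularization k g x = (INF y. g y + k * dist x y)"

context
  fixes g :: "'a::metric_space \<Rightarrow> real" and k :: real
  assumes g_nonneg: "\<And>x. 0 \<le> g x" and k_nonneg: "0 \<le> k"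
begin

lemma lipschitz_regularization_le_at:
  "lipschitz_regularization k g x \<le> g y + k * dist x y"
  unfolding lipschitz_regularization_def
  by (rule cINF_lower) (auto intro!: bdd_belowI[of _ 0] simp: g_nonneg k_nonneg)

lemma lipschitz_regularization_le: "lipschitz_regularization k g x \<le> g x"
  using lipschitz_regularization_le_at[of x x] by simp

lemma continuous_on_lipschitz_regularization:
  "continuous_on UNIV (lipschitz_regularization k g)"
proof -
  let ?r = "lipschitz_regularization k g"
  have le: "?r x \<le> ?r z + k * dist x z" for x z
  proof -
    have "?r x - k * dist x z \<le> ?r z"
      unfolding lipschitz_regularization_def[of k g z]
    proof (rule cINF_greatest)
      fix y
      have "k * dist x y \<le> k * (dist x z + dist z y)"
        by (intro mult_left_mono dist_triangle k_nonneg)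
      then show "?r x - k * dist x z \<le> g y + k * dist z y"
        using lipschitz_regularization_le_at[of x y] by (simp add: algebra_simps)
    qed simp
    then show ?thesis by simp
  qed
  have "k-lipschitz_on UNIV ?r"
    using k_nonneg le
    by (intro lipschitz_onI) (force simp: dist_real_def abs_le_iff dist_commute algebra_simps)+
  then show ?thesis by (rule lipschitz_on_continuous_on)
qed

text \<open>Points within \<open>\<delta>\<close> of \<open>x\<close> contribute at least \<open>m\<close> through \<open>g\<close>, all others at least \<open>k * \<delta>\<close>
  through the distance.\<close>

lemma lipschitz_regularization_ge:
  assumes "\<And>y. dist y x < \<delta> \<Longrightarrow> m \<le> g y"
  shows "min m (k * \<delta>) \<le> lipschitz_regularization k g x"
  unfolding lipschitz_regularization_def
proof (rule cINF_greatest)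
  fix y
  show "min m (k * \<delta>) \<le> g y + k * dist x y"
  proof (cases "dist y x < \<delta>")
    case True
    then show ?thesis
      using assms[of y] mult_nonneg_nonneg[OF k_nonneg zero_le_dist[of x y]] by linarith
  next
    case False
    then have "k * \<delta> \<le> k * dist x y"
      by (intro mult_left_mono k_nonneg) (simp add: dist_commute)
    then show ?thesis using g_nonneg[of y] by linarith
  qed
qed simp

end

text \<open>The Lipschitz regularization needs a function that is bounded below, and a minorant of a
  positive function must stay positive for its logarithm to make sense; passing to \<open>exp \<circ> r\<close>
  achieves the first, and lower semicontinuity the second.\<close>

lemma lsc_continuous_minorant:
  fixes r :: "'a::metric_space \<Rightarrow> real"
  assumes lsc: "\<And>x t. t < r x \<Longrightarrow> eventually (\<lambda>y. t < r y) (nhds x)"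
    and t: "t < r x"
  obtains c where "continuous_on UNIV c" "\<And>y. c y \<le> r y" "t < c x"
proof -
  define g where "g y = exp (r y)" for y
  have g_nonneg: "0 \<le> g y" for y by (simp add: g_def)
  have ball: "\<exists>\<delta>>0. \<forall>y. dist y z < \<delta> \<longrightarrow> exp s \<le> g y" if "s < r z" for s z
    using lsc[OF that] by (auto simp: eventually_nhds_metric g_def intro: less_imp_le)
  obtain s where s: "t < s" "s < r x"
    using t dense by blast
  obtain \<delta> where \<delta>: "\<delta> > 0" "\<And>y. dist y x < \<delta> \<Longrightarrow> exp s \<le> g y"
    using ball[OF s(2)] by auto
  \<comment> \<open>With this slope, points at distance \<open>\<delta>\<close> or more from \<open>x\<close> contribute at least \<open>exp s\<close>.\<close>
  define k where "k = exp s / \<delta>"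
  have k: "0 < k" "k * \<delta> = exp s" using \<delta>(1) by (simp_all add: k_def)
  let ?R = "lipschitz_regularization k g"
  have R_le: "?R y \<le> g y" for y
    using lipschitz_regularization_le[of g, OF g_nonneg] k by simp
  have R_pos: "0 < ?R z" for z
  proof -
    \<comment> \<open>Any level below \<open>r z\<close> would do in place of \<open>r z - 1\<close>.\<close>
    obtain \<eta> where \<eta>: "\<eta> > 0" "\<And>y. dist y z < \<eta> \<Longrightarrow> exp (r z - 1) \<le> g y"
      using ball[of "r z - 1" z] by auto
    have "0 < min (exp (r z - 1)) (k * \<eta>)"
      using \<eta>(1) k by simp
    also have "\<dots> \<le> ?R z"
      using lipschitz_regularization_ge[of g k z \<eta> "exp (r z - 1)", OF g_nonneg _ \<eta>(2)] k by simp
    finally show ?thesis .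
  qed
  have "exp s \<le> ?R x"
    using lipschitz_regularization_ge[of g k x \<delta> "exp s", OF g_nonneg _ \<delta>(2)] k by simp
  then have "s \<le> ln (?R x)"
    using R_pos[of x] by (simp add: ln_ge_iff)
  moreover have "ln (?R y) \<le> r y" for y
    using R_le[of y] R_pos[of y] by (metis exp_gt_zero g_def ln_exp ln_le_cancel_iff)
  moreover have "continuous_on UNIV (\<lambda>y. ln (?R y))"
    using R_pos continuous_on_lipschitz_regularization[of g, OF g_nonneg, of k] k
    by (intro continuous_on_ln) (auto simp: less_imp_neq[symmetric])
  ultimately show ?thesis
    using that[of "\<lambda>y. ln (?R y)"] s by fastforce
qed

lemma H_ft_lub_of_continuous:
  fixes q :: "'a::metric_space \<Rightarrow> ereal interval"
  assumes q: "q \<in> H_ft"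
  shows "\<exists>A\<subseteq>C_fun. is_lub (pointwise_order H_ft) q A"
proof -
  define A where "A = {f \<in> C_fun. \<forall>x. interval_le (f x) (q x)}"
  have A_C: "A \<subseteq> C_fun" by (auto simp: A_def)
  have Hq: "H_continuous q" using q by (simp add: H_ft_def)
  define r where "r x = real_of_ereal (lower (q x))" for x
  have r: "ereal (r x) = lower (q x)" for x
    unfolding r_def by (rule H_ft_lower_real[OF q])
  have lsc: "eventually (\<lambda>y. t < r y) (nhds x)" if "t < r x" for t x
  proof -
    have "ereal t < Liminf (nhds x) (\<lambda>y. lower (q y))"
      unfolding Liminf_lower_H_continuous[OF Hq] using that by (simp flip: r)
    then show ?thesis
      by (auto dest!: less_LiminfD simp flip: r)
  qed
  have least: "\<forall>x. interval_le (q x) (h x)"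
    if h: "h \<in> H_ft" "\<And>f. f \<in> A \<Longrightarrow> \<forall>x. interval_le (f x) (h x)" for h
  proof -
    have "lower (q x) \<le> lower (h x)" for x
    proof (rule ccontr)
      assume "\<not> lower (q x) \<le> lower (h x)"
      moreover have "lower (h x) = ereal (real_of_ereal (lower (h x)))"
        by (rule H_ft_lower_real[OF h(1), symmetric])
      ultimately obtain t where t: "lower (h x) = ereal t" "t < r x"
        by (metis r not_le less_ereal.simps(1))
      then obtain c where c: "continuous_on UNIV c" "\<And>y. c y \<le> r y" "t < c x"
        using lsc_continuous_minorant[OF lsc] by blast
      let ?c = "\<lambda>y. interval_of (ereal (c y))"
      have C: "?c \<in> C_fun" using c(1) by (auto simp: C_fun_def)
      then have "H_continuous ?c" using C_fun_subset_H_ft by (auto simp: H_ft_def)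
      then have "?c \<in> A"
        using H_le_iff_lower[of ?c q] Hq C c(2) by (simp add: A_def flip: r)
      from h(2)[OF this] have "ereal (c x) \<le> lower (h x)"
        by (simp add: interval_le_def)
      with t c(3) show False by simp
    qed
    then show ?thesis
      using H_le_iff_lower[OF Hq] h(1) by (simp add: H_ft_def)
  qed
  have "is_lub (pointwise_order H_ft) q A"
    using q least A_C C_fun_subset_H_ft
    by (intro is_lub_pointwise_orderI) (blast, assumption, simp add: A_def, blast)
  with A_C show ?thesis by blast
qed

text \<open>Reflecting the range exchanges the two end points and reverses the order, and it preserves
  both H-continuity and continuity; this reduces infima to suprema.\<close>

definition reflect :: "('a \<Rightarrow> ereal interval) \<Rightarrow> 'a \<Rightarrow> ereal interval" where
  "reflect f x = Interval (- upper (f x), - lower (f x))"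

lemma lower_reflect [simp]: "lower (reflect f x) = - upper (f x)"
  and upper_reflect [simp]: "upper (reflect f x) = - lower (f x)"
proof -
  have "lower (Interval (a, b)) = a" "upper (Interval (a, b)) = b" if "a \<le> b" for a b :: ereal
    using that by (simp_all add: lower_def upper_def Interval_inverse)
  then show "lower (reflect f x) = - upper (f x)" "upper (reflect f x) = - lower (f x)"
    by (simp_all add: reflect_def)
qed

lemma reflect_reflect [simp]: "reflect (reflect f) = f"
  by (simp add: fun_eq_iff interval_eq_iff)

lemma interval_le_reflect: "interval_le (reflect f x) (g x) \<longleftrightarrow> interval_le (reflect g x) (f x)"
  by (auto simp: interval_le_def ereal_uminus_le_reorder)

lemma reflect_in_H_ft: "reflect f \<in> H_ft" if "f \<in> H_ft"
  using that
  by (auto simp: H_ft_iff_finite_ends H_continuous_iff ereal_Limsup_uminus ereal_Liminf_uminus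
      ereal_uminus_less_reorder ereal_less_uminus_reorder ereal_uminus_eq_reorder)

lemma reflect_in_C_fun: "reflect f \<in> C_fun" if "f \<in> C_fun"
proof -
  obtain c where c: "f = (\<lambda>x. interval_of (ereal (c x)))" "continuous_on UNIV c"
    using \<open>f \<in> C_fun\<close> by (auto simp: C_fun_def)
  then have "reflect f = (\<lambda>x. interval_of (ereal (- c x)))" "continuous_on UNIV (\<lambda>x. - c x)"
    by (auto simp: fun_eq_iff interval_eq_iff intro: continuous_on_minus)
  then show ?thesis unfolding C_fun_def by (intro CollectI exI conjI)
qed

lemma H_ft_glb_of_continuous:
  fixes q :: "'a::metric_space \<Rightarrow> ereal interval"
  assumes q: "q \<in> H_ft"
  shows "\<exists>B\<subseteq>C_fun. is_glb (pointwise_order H_ft) q B"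
proof -
  obtain A where A: "A \<subseteq> C_fun" and lub: "is_lub (pointwise_order H_ft) (reflect q) A"
    using H_ft_lub_of_continuous[OF reflect_in_H_ft[OF q]] by blast
  have AH: "A \<subseteq> H_ft" using A C_fun_subset_H_ft by blast
  have "is_glb (pointwise_order H_ft) q (reflect ` A)"
    unfolding greatest_def
  proof (intro conjI ballI)
    show "q \<in> Lower (pointwise_order H_ft) (reflect ` A)"
    proof (rule Lower_memI)
      fix g assume "g \<in> reflect ` A"
      then obtain f where f: "f \<in> A" "g = reflect f" by blast
      then have "\<forall>x. interval_le (f x) (reflect q x)"
        using lub AH by (auto simp: least_def Upper_def)
      then show "q \<sqsubseteq>\<^bsub>pointwise_order H_ft\<^esub> g"
        using interval_le_reflect[of "reflect q" _ "reflect f"] f(2) by simp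
    qed (simp add: q)
    fix h assume h: "h \<in> Lower (pointwise_order H_ft) (reflect ` A)"
    then have hH: "h \<in> H_ft" by (simp add: Lower_def)
    have "\<forall>x. interval_le (f x) (reflect h x)" if "f \<in> A" for f
    proof -
      have "\<forall>x. interval_le (h x) (reflect f x)"
        using h that AH by (auto simp: Lower_def intro: reflect_in_H_ft)
      then show ?thesis
        using interval_le_reflect[of "reflect h" _ "reflect f"] by simp
    qed
    then have "reflect h \<in> Upper (pointwise_order H_ft) A"
      using reflect_in_H_ft[OF hH] by (auto intro: Upper_memI)
    then have "\<forall>x. interval_le (reflect q x) (reflect h x)"
      using lub by (auto simp: least_def)
    then show "h \<sqsubseteq>\<^bsub>pointwise_order H_ft\<^esub> q"
      using interval_le_reflect[of q _ "reflect h"] by simp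
  qed (auto simp: Lower_def)
  moreover have "reflect ` A \<subseteq> C_fun" using A reflect_in_C_fun by blast
  ultimately show ?thesis by blast
qed

theorem corollary1:
  shows "is_dedekind_completion
    (pointwise_order (H_ft :: ('a::metric_space \<Rightarrow> ereal interval) set)) C_fun"
  unfolding is_dedekind_completion_def carrier_pointwise_order
  using C_fun_subset_H_ft dedekind_order_complete_H_ft
    H_ft_lub_of_continuous H_ft_glb_of_continuous
  by blast

end
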